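(* Let $n$ be a natural number and $p$ a prime number. Then $p \mid n^p+(p-1)n$. *)

theory Defs
  imports "HOL-Number_Theory.Number_Theory"
begin

end

theory Submission
  imports Defs
begin

text \<open>The sum factors as \<open>n * (n ^ (p - 1) + (p - 1))\<close>. If \<open>p\<close> does
  not divide \<open>n\<close>, Fermat's little theorem (\<open>fermat_theorem\<close>) makes the
  second factor congruent to \<open>1 + (p - 1)\<close>, that is, to 0 modulo
  \<open>p\<close>.\<close>

theorem proposition8:
  fixes n p :: nat
  assumes "prime p"
  shows "p dvd n ^ p + (p - 1) * n"
proof -
  have p: "p > 0" using assms by (rule prime_gt_0_nat)
  have eq: "n ^ p + (p - 1) * n = n * (n ^ (p - 1) + (p - 1))"
    using power_minus_mult[OF p, of n] by (simp add: distrib_left mult.commute)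
  show ?thesis
  proof (cases "p dvd n")
    case True
    then show ?thesis unfolding eq by (rule dvd_mult2)
  next
    case False
    have "[n ^ (p - 1) + (p - 1) = 1 + (p - 1)] (mod p)"
      using fermat_theorem[OF assms False] by (rule cong_add) (rule cong_refl)
    then have "p dvd n ^ (p - 1) + (p - 1)"
      \<comment> \<open>Subtraction on \<open>nat\<close> truncates; \<open>p > 0\<close> ensures
        that \<open>1 + (p - 1)\<close> is \<open>p\<close> itself.\<close>
      using p by (simp add: cong_dvd_iff)
    then show ?thesis unfolding eq by (rule dvd_mult)
  qed
qed

end
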